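(* Let $r_1,r_2,\rho_1,\rho_2$ be real numbers with $\rho_1+\rho_2-r_1-r_2\notin\{-1,-2,\dots\}$. Put $$q=-e^{\varepsilon},\quad a=-ie^{\varepsilon(2\rho_1+1/2)},\quad b=-ie^{\varepsilon(2\rho_2+1/2)},\quad c=ie^{\varepsilon(-2r_2+1/2)},\quad d=ie^{\varepsilon(-2r_1+1/2)},\quad z=ie^{-2\varepsilon y}$$ with $y$ real, and let $R_n(x(z))$, $x(z)=(z+z^{-1})/2$, be the Askey-Wilson polynomials with parameters $a,b,c,d$, normalized as in the context. Then the limit $$\lim_{q\to-1}R_n(x(z))=R_n^{(-1)}(y)\qquad(\text{i.e. }\varepsilon\to0)$$ exists and is a polynomial of degree $n$ in $y$. These limiting polynomials satisfy $$A_n^{(-1)}R_{n+1}^{(-1)}(y)+\left(\tfrac14+\rho_1-A_n^{(-1)}-C_n^{(-1)}\right)R_n^{(-1)}(y)+C_n^{(-1)}R_{n-1}^{(-1)}(y)=yR_n^{(-1)}(y),$$ where, with $g=\rho_1+\rho_2-r_1-r_2$, $$A_n^{(-1)}=\begin{cases}\frac{(n+1+2\rho_1-2r_1)(n+1+2\rho_1-2r_2)}{4(n+1+g)},& n\text{ even},\\ \frac{(n+1+2g)(n+1+2\rho_1+2\rho_2)}{4(n+1+g)},& n\text{ odd},\end{cases}\qquad C_n^{(-1)}=\begin{cases}-\frac{n(n-2r_1-2r_2)}{4(n+g)},& n\text{ even},\\ -\frac{(n-2r_2+2\rho_2)(n-2r_1+2\rho_2)}{4(n+g)},& n\text{ odd}\end{cases}$$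 (with $C_0^{(-1)}=0$). Hence the monic version $\hat R_n^{(-1)}$ of $R_n^{(-1)}$ is, up to a shift of the argument, the monic Bannai-Ito polynomial: $$\hat R_n^{(-1)}(y)=P_n\!\left(y-\tfrac14;r_1,r_2,\rho_1,\rho_2\right).$$
   Context: The Askey-Wilson polynomials are taken as $$R_n(x(z))={}_4\Phi_3\left({q^{-n},\,abcdq^{n-1},\,az,\,az^{-1}\atop ab,\,ac,\,ad}\,\Big|\,q;q\right)$$ (parameters being such that this terminating series is defined). They satisfy $A_nR_{n+1}+(a+a^{-1}-A_n-C_n)R_n+C_nR_{n-1}=(z+z^{-1})R_n$ with $$A_n=\frac{(1-abq^n)(1-acq^n)(1-adq^n)(1-abcdq^{n-1})}{a(1-abcdq^{2n-1})(1-abcdq^{2n})},\qquad C_n=\frac{a(1-q^n)(1-bcq^{n-1})(1-bdq^{n-1})(1-cdq^{n-1})}{(1-abcdq^{2n-1})(1-abcdq^{2n-2})}.$$ The monic Bannai-Ito polynomials $P_n(x)=P_n(x;r_1,r_2,\rho_1,\rho_2)$ are defined by $P_{-1}=0$, $P_0=1$ and $$P_{n+1}(x)+(\rho_1-A_n^{(-1)}-C_n^{(-1)})P_n(x)+A_{n-1}^{(-1)}C_n^{(-1)}P_{n-1}(x)=xP_n(x).$$ *)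

theory Defs
  imports Complex_Main "HOL-Computational_Algebra.Polynomial"
begin

definition qpoch :: "complex \<Rightarrow> complex \<Rightarrow> nat \<Rightarrow> complex" where
  "qpoch a q k = (\<Prod>j<k. 1 - a * q ^ j)"

definition Phi43 ::
  "complex \<Rightarrow> complex \<Rightarrow> complex \<Rightarrow> complex \<Rightarrow>
   complex \<Rightarrow> complex \<Rightarrow> complex \<Rightarrow> complex \<Rightarrow> complex \<Rightarrow> complex" where
  "Phi43 a1 a2 a3 a4 b1 b2 b3 q x =
     (\<Sum>k. qpoch a1 q k * qpoch a2 q k * qpoch a3 q k * qpoch a4 q k /
          (qpoch b1 q k * qpoch b2 q k * qpoch b3 q k * qpoch q q k) * x ^ k)"

text \<open>
  The value of the Askey-Wilson polynomial \<open>R\<^sub>n\<close> at the point \<open>x(z) = (z + 1/z) / 2\<close>, given as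
  a function of \<open>z\<close>. For \<open>q \<noteq> 0\<close> the factor \<open>qpoch (q powi - int n) q k\<close> vanishes for \<open>k > n\<close>,
  so all terms of the series beyond the \<open>n\<close>-th are zero (also where a denominator vanishes,
  because \<open>0 / 0 = 0\<close>).
\<close>

definition askey_wilson ::
  "nat \<Rightarrow> complex \<Rightarrow> complex \<Rightarrow> complex \<Rightarrow> complex \<Rightarrow> complex \<Rightarrow> complex \<Rightarrow> complex" where
  "askey_wilson n a b c d q z =
     Phi43 (q powi (- int n)) (a * b * c * d * q powi (int n - 1)) (a * z) (a * inverse z)
           (a * b) (a * c) (a * d) q q"

definition askey_wilson_defined ::
  "nat \<Rightarrow> complex \<Rightarrow> complex \<Rightarrow> complex \<Rightarrow> complex \<Rightarrow> complex \<Rightarrow> bool" where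
  "askey_wilson_defined n a b c d q \<longleftrightarrow>
     (\<forall>k\<le>n. qpoch (a * b) q k * qpoch (a * c) q k * qpoch (a * d) q k * qpoch q q k \<noteq> 0)"

definition BI_A :: "real \<Rightarrow> real \<Rightarrow> real \<Rightarrow> real \<Rightarrow> nat \<Rightarrow> real" where
  "BI_A r1 r2 \<rho>1 \<rho>2 n =
     (let g = \<rho>1 + \<rho>2 - r1 - r2 in
      if even n
      then (real n + 1 + 2 * \<rho>1 - 2 * r1) * (real n + 1 + 2 * \<rho>1 - 2 * r2) / (4 * (real n + 1 + g))
      else (real n + 1 + 2 * g) * (real n + 1 + 2 * \<rho>1 + 2 * \<rho>2) / (4 * (real n + 1 + g)))"

definition BI_C :: "real \<Rightarrow> real \<Rightarrow> real \<Rightarrow> real \<Rightarrow> nat \<Rightarrow> real" where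
  "BI_C r1 r2 \<rho>1 \<rho>2 n =
     (let g = \<rho>1 + \<rho>2 - r1 - r2 in
      if n = 0 then 0
      else if even n
      then - (real n * (real n - 2 * r1 - 2 * r2) / (4 * (real n + g)))
      else - ((real n - 2 * r2 + 2 * \<rho>2) * (real n - 2 * r1 + 2 * \<rho>2) / (4 * (real n + g))))"

text \<open>
  The second equation is the three-term recurrence at \<open>n = 0\<close> with \<open>P\<^bsub>-1\<^esub> = 0\<close>;
  the polynomial \<open>[:- t, 1:]\<close> is \<open>x - t\<close>.
\<close>

fun bannai_ito :: "real \<Rightarrow> real \<Rightarrow> real \<Rightarrow> real \<Rightarrow> nat \<Rightarrow> real poly" where
  "bannai_ito r1 r2 \<rho>1 \<rho>2 0 = 1"
| "bannai_ito r1 r2 \<rho>1 \<rho>2 (Suc 0) =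
     [:- (\<rho>1 - BI_A r1 r2 \<rho>1 \<rho>2 0 - BI_C r1 r2 \<rho>1 \<rho>2 0), 1:]"
| "bannai_ito r1 r2 \<rho>1 \<rho>2 (Suc (Suc n)) =
     [:- (\<rho>1 - BI_A r1 r2 \<rho>1 \<rho>2 (Suc n) - BI_C r1 r2 \<rho>1 \<rho>2 (Suc n)), 1:]
        * bannai_ito r1 r2 \<rho>1 \<rho>2 (Suc n)
     - smult (BI_A r1 r2 \<rho>1 \<rho>2 n * BI_C r1 r2 \<rho>1 \<rho>2 (Suc n)) (bannai_ito r1 r2 \<rho>1 \<rho>2 n)"

definition monic_version :: "real poly \<Rightarrow> real poly" where
  "monic_version p = smult (inverse (lead_coeff p)) p"

end

theory Submission
  imports Defs
begin

text \<open>
  Why it is true. Write the \<open>k\<close>-th term of the series as a product over \<open>j < k\<close> of quotients of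
  four factors by four factors (times \<open>q\<close>). With the given parameters each of the eight factors has
  the shape \<open>1 - (-1)\<^sup>m exp (\<epsilon> u)\<close>: for odd \<open>m\<close> it tends to \<open>2\<close>, for even \<open>m\<close> it is \<open>- \<epsilon> u\<close> to first
  order. The eight factors group into four pairs with exponents of opposite parity, two pairs
  above and two below the fraction bar, so the powers of \<open>\<epsilon>\<close> cancel and the quotient has the limit
  \<open>- num_factor * lin_factor / den_factor\<close> (\<open>tendsto_wave_pair\<close>). That the series is defined
  for \<open>\<epsilon>\<close> near \<open>0\<close> says precisely that the limiting denominators do not vanish: a vanishing one
  comes from a factor that is zero for all \<open>\<epsilon>\<close>.

  The limit is thus an explicit combination \<open>lim_poly\<close> of the Newton basis
  \<open>\<Phi>\<^sub>k(y) = (\<Prod>j<k. lin_factor j)\<close>. Its degree is \<open>n\<close> because the numerators in the top coefficient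
  are of the form \<open>j - n\<close>, \<open>j < n\<close>, or \<open>2 (g + i)\<close>, \<open>i \<ge> 1\<close>, and \<open>g\<close> is not a negative integer.

  The recurrence is not taken over from the Askey-Wilson recurrence but proved for the limit. Since
  \<open>y \<Phi>\<^sub>k\<close> is a combination of \<open>\<Phi>\<^sub>k\<close> and \<open>\<Phi>\<^bsub>k+1\<^esub>\<close>, comparing coefficients turns it into a relation
  between the numerator products for \<open>n - 1\<close>, \<open>n\<close>, \<open>n + 1\<close> (\<open>num_prod_recurrence\<close>). These
  products agree up to the factors at their ends (\<open>num_prod_up_even\<close>, \<open>num_prod_up_odd\<close>), which
  reduces the relation to polynomial identities, one for each parity of \<open>n\<close> and \<open>k\<close>. Finally, the
  recurrence and its leading coefficient determine the monic version, which therefore satisfies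
  the recursion that defines the Bannai-Ito polynomials at the shifted argument.
\<close>

section \<open>The limiting polynomials\<close>

text \<open>
  Up to the factor \<open>- 2 \<epsilon>\<close>, the limit of \<open>(1 - q\<^bsup>j-n\<^esup>) (1 - a b c d q\<^bsup>n+j-1\<^esup>)\<close>; the parity of
  \<open>n + j\<close> decides which of the two factors vanishes in the limit.
\<close>

definition num_factor :: "real \<Rightarrow> nat \<Rightarrow> nat \<Rightarrow> real" where
  "num_factor g n j = (if even (n + j) then real j - real n else 2 * g + 1 + real n + real j)"

text \<open>
  Up to the factor \<open>4 \<epsilon>\<^sup>2\<close>, the limit of \<open>(1 - a b q\<^sup>j) (1 - a c q\<^sup>j) (1 - a d q\<^sup>j) (1 - q\<^bsup>j+1\<^esup>)\<close>.
\<close>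

definition den_factor :: "real \<Rightarrow> real \<Rightarrow> real \<Rightarrow> real \<Rightarrow> nat \<Rightarrow> real" where
  "den_factor r1 r2 \<rho>1 \<rho>2 j =
     (if even j then (2 * \<rho>1 - 2 * r2 + 1 + real j) * (2 * \<rho>1 - 2 * r1 + 1 + real j)
      else (2 * \<rho>1 + 2 * \<rho>2 + 1 + real j) * (real j + 1))"

text \<open>Up to the factor \<open>- 2 \<epsilon>\<close>, the limit of \<open>(1 - a z q\<^sup>j) (1 - a z\<^bsup>-1\<^esup> q\<^sup>j)\<close> as a polynomial in \<open>y\<close>.\<close>

definition lin_factor :: "real \<Rightarrow> nat \<Rightarrow> real poly" where
  "lin_factor \<rho>1 j = [:2 * \<rho>1 + 1/2 + real j, - 2 * (- 1) ^ j:]"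

definition num_prod :: "real \<Rightarrow> nat \<Rightarrow> nat \<Rightarrow> real" where
  "num_prod g n k = (\<Prod>j<k. num_factor g n j)"

definition lim_coeff :: "real \<Rightarrow> real \<Rightarrow> real \<Rightarrow> real \<Rightarrow> nat \<Rightarrow> nat \<Rightarrow> real" where
  "lim_coeff r1 r2 \<rho>1 \<rho>2 n k =
     (- 1) ^ k * num_prod (\<rho>1 + \<rho>2 - r1 - r2) n k / (\<Prod>j<k. den_factor r1 r2 \<rho>1 \<rho>2 j)"

definition lim_poly :: "real \<Rightarrow> real \<Rightarrow> real \<Rightarrow> real \<Rightarrow> nat \<Rightarrow> real poly" where
  "lim_poly r1 r2 \<rho>1 \<rho>2 n =
     (\<Sum>k\<le>n. smult (lim_coeff r1 r2 \<rho>1 \<rho>2 n k) (\<Prod>j<k. lin_factor \<rho>1 j))"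

section \<open>Contiguity of the numerator products\<close>

lemma num_prod_0 [simp]: "num_prod g n 0 = 1"
  by (simp add: num_prod_def)

lemma num_prod_Suc: "num_prod g n (Suc k) = num_prod g n k * num_factor g n k"
  by (simp add: num_prod_def)

lemma num_prod_eq_0: "n < k \<Longrightarrow> num_prod g n k = 0"
  unfolding num_prod_def by (rule prod_zero) (auto simp: num_factor_def)

text \<open>
  Passing from \<open>n\<close> to \<open>n + 1\<close> moves the factors \<open>j - n\<close> to the next index and the other ones to the
  previous index. For even \<open>n\<close> an even number of factors is merely permuted; for odd \<open>n\<close> one factor
  of each kind is exchanged at the ends of the product. The odd case is stated without division,
  since the exchanged factors may vanish.
\<close>

lemma num_prod_up_even:
  assumes "even n"
  shows "num_prod g (Suc n) (2 * m) = num_prod g n (2 * m)"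
  using assms by (induction m) (simp_all add: num_prod_Suc num_factor_def algebra_simps)

lemma num_prod_up_odd:
  assumes "odd n"
  shows "num_prod g n (2 * m) * ((real n + 1) * (2 * g + real n + 1 + 2 * real m)) =
         num_prod g (Suc n) (2 * m) * ((real n + 1 - 2 * real m) * (2 * g + real n + 1))"
proof (induction m)
  case 0
  then show ?case by simp
next
  case (Suc m)
  let ?s = "2 * g + real n + 1 + 2 * real m" and ?t = "2 * real m + 1 - real n"
  have 1: "num_prod g n (2 * Suc m) = num_prod g n (2 * m) * (?s * ?t)"
    using assms by (simp add: num_prod_Suc num_factor_def algebra_simps)
  have 2: "num_prod g (Suc n) (2 * Suc m) =
      num_prod g (Suc n) (2 * m) * ((2 * real m - real n - 1) * (?s + 2))"
    using assms by (simp add: num_prod_Suc num_factor_def algebra_simps)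
  have "num_prod g n (2 * Suc m) * ((real n + 1) * (?s + 2)) =
      (num_prod g n (2 * m) * ((real n + 1) * ?s)) * (?t * (?s + 2))"
    unfolding 1 by algebra
  also have "\<dots> = num_prod g (Suc n) (2 * m) * ((real n + 1 - 2 * real m) * (2 * g + real n + 1)) * (?t * (?s + 2))"
    by (simp only: Suc)
  also have "\<dots> = num_prod g (Suc n) (2 * Suc m) * ((- ?t) * (2 * g + real n + 1))"
    unfolding 2 by algebra
  also have "- ?t = real n + 1 - 2 * real (Suc m)" by simp
  also have "?s + 2 = 2 * g + real n + 1 + 2 * real (Suc m)" by simp
  finally show ?case .
qed

lemma quot_cancel:
  fixes v :: real
  assumes "v \<noteq> 0"
  shows "x / (4 * v) * (p * (y * (2 * v))) = p * (x * y / 2)"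
  using assms by (simp add: field_simps)

text \<open>
  The three-term recurrence, read off at the basis polynomial \<open>\<Phi>\<^bsub>k+1\<^esub>\<close>. The coefficient of
  \<open>num_prod g n (Suc k)\<close> contains \<open>- A - C\<close>, so only the differences \<open>F1\<close> and \<open>F2\<close> of neighbouring
  products enter. By contiguity each of them is a multiple of \<open>P = num_prod g n k\<close> in which the
  denominator of \<open>A\<close> or of \<open>C\<close> cancels, and what is left is a polynomial identity.
\<close>

lemma num_prod_recurrence:
  fixes r1 r2 \<rho>1 \<rho>2 :: real and n k :: nat
  defines "g \<equiv> \<rho>1 + \<rho>2 - r1 - r2"
  defines "A \<equiv> BI_A r1 r2 \<rho>1 \<rho>2 n" and "C \<equiv> BI_C r1 r2 \<rho>1 \<rho>2 n"
  assumes g: "\<And>k::nat. k \<ge> 1 \<Longrightarrow> g \<noteq> - real k"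
  shows "A * num_prod g (Suc n) (Suc k)
       + (1/4 + \<rho>1 - A - C + (- 1) ^ k * (2 * \<rho>1 + 1/2 + real (Suc k)) / 2) * num_prod g n (Suc k)
       + C * num_prod g (n - 1) (Suc k)
       = (- 1) ^ k / 2 * den_factor r1 r2 \<rho>1 \<rho>2 k * num_prod g n k"
proof -
  define u v P where "u = real n + 1 + g" and "v = real n + g" and "P = num_prod g n k"
  have u: "u \<noteq> 0" and v: "n \<noteq> 0 \<Longrightarrow> v \<noteq> 0"
    using g[of "Suc n"] g[of n] by (auto simp: u_def v_def)
  define F1 where "F1 = A * (num_prod g (Suc n) (Suc k) - num_prod g n (Suc k))"
  define F2 where "F2 = C * (num_prod g (n - 1) (Suc k) - num_prod g n (Suc k))"
  have split: "A * num_prod g (Suc n) (Suc k)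
       + (1/4 + \<rho>1 - A - C + (- 1) ^ k * (2 * \<rho>1 + 1/2 + real (Suc k)) / 2) * num_prod g n (Suc k)
       + C * num_prod g (n - 1) (Suc k)
     = F1 + F2 + (1/4 + \<rho>1 + (- 1) ^ k * (2 * \<rho>1 + 1/2 + real (Suc k)) / 2) * (P * num_factor g n k)"
    by (simp add: F1_def F2_def P_def num_prod_Suc algebra_simps)
  obtain m where m: "k = 2 * m \<or> k = Suc (2 * m)"
    by (metis oddE evenE Suc_eq_plus1)
  show ?thesis
  proof (cases "even n")
    case True
    let ?M = "num_prod g n (2 * m)"
    have A: "A = (real n + 1 + 2 * \<rho>1 - 2 * r1) * (real n + 1 + 2 * \<rho>1 - 2 * r2) / (4 * u)"
      using True by (simp add: A_def BI_A_def Let_def g_def u_def)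
    have C: "C = - (real n * (real n - 2 * r1 - 2 * r2) / (4 * v))" if "n > 0"
      using True that by (simp add: C_def BI_C_def Let_def g_def v_def)
    have C0: "C = 0" if "n = 0"
      using that by (simp add: C_def BI_C_def)
    have up: "num_prod g (Suc n) (2 * m) = ?M"
      by (rule num_prod_up_even[OF True])
    have down: "num_prod g (n - 1) (2 * m) * (real n * (2 * g + real n + 2 * real m)) =
        ?M * ((real n - 2 * real m) * (2 * g + real n))" if "n > 0"
      using num_prod_up_odd[of "n - 1" g m] that True by (simp add: of_nat_diff)
    show ?thesis
    proof (cases "k = 2 * m")
      case k: True
      have num: "num_factor g n k = 2 * real m - real n" "num_factor g (Suc n) k = 2 * g + 2 + real n + 2 * real m"
        using True by (simp_all add: k num_factor_def)
      have F1: "F1 = P * ((real n + 1 + 2 * \<rho>1 - 2 * r1) * (real n + 1 + 2 * \<rho>1 - 2 * r2) / 2)"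
      proof -
        have "F1 = A * (P * (2 * u))"
          by (simp add: F1_def num_prod_Suc num up[folded k] P_def[symmetric] u_def algebra_simps)
        then show ?thesis using u by (simp add: A)
      qed
      have F2: "F2 = P * (- ((real n - 2 * r1 - 2 * r2) * (real n - 2 * real m) / 2))"
      proof (cases "n = 0")
        \<comment> \<open>\<open>v = g\<close> may vanish here, but \<open>C = 0\<close>; the right-hand side vanishes because of \<open>m\<close> or \<open>P\<close>.\<close>
        case n0: True
        show ?thesis
        proof (cases "m = 0")
          case True
          then show ?thesis by (simp add: F2_def C0 n0)
        next
          case False
          then have "P = 0" by (simp add: P_def k n0 num_prod_eq_0)
          then show ?thesis by (simp add: F2_def C0 n0)
        qed
      next
        case False
        then have "num_factor g (n - 1) k = 2 * g + real n + 2 * real m"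
          using True by (simp add: k num_factor_def of_nat_diff)
        then have "real n * num_prod g (n - 1) (Suc k) =
            num_prod g (n - 1) (2 * m) * (real n * (2 * g + real n + 2 * real m))"
          by (simp add: num_prod_Suc k)
        also have "\<dots> = P * ((real n - 2 * real m) * (2 * g + real n))"
          using down False by (simp add: P_def k)
        finally have "real n * (num_prod g (n - 1) (Suc k) - num_prod g n (Suc k)) =
            P * ((real n - 2 * real m) * (2 * v))"
          by (simp add: num_prod_Suc[of g n k] num P_def[symmetric] v_def algebra_simps)
        moreover have "F2 = - ((real n - 2 * r1 - 2 * r2) / (4 * v)) *
           (real n * (num_prod g (n - 1) (Suc k) - num_prod g n (Suc k)))"
          using False by (simp add: F2_def C mult_ac)
        ultimately have "F2 = - ((real n - 2 * r1 - 2 * r2) / (4 * v)) * (P * ((real n - 2 * real m) * (2 * v)))"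
          by (simp only:)
        then show ?thesis
          by (simp only: mult_minus_left mult_minus_right quot_cancel[OF v[OF False]]; simp add: algebra_simps)
      qed
      show ?thesis
        unfolding split F1 F2 P_def[symmetric] num
        by (simp add: den_factor_def k g_def field_simps)
    next
      case False
      then have k: "k = Suc (2 * m)" using m by blast
      have num: "num_factor g n k = 2 * g + 2 + real n + 2 * real m"
        "num_factor g (Suc n) k = 2 * real m - real n"
        "num_factor g n (2 * m) = 2 * real m - real n" "num_factor g (Suc n) (2 * m) = 2 * g + 2 + real n + 2 * real m"
        using True by (simp_all add: k num_factor_def)
      have F1: "F1 = 0"
        by (simp add: F1_def num_prod_Suc k up num[unfolded k])
      have F2: "F2 = P * ((real n - 2 * r1 - 2 * r2) * (real m + 1))"
      proof (cases "n = 0")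
        case True
        then have "P = 0" by (simp add: P_def k num_prod_eq_0)
        then show ?thesis by (simp add: F2_def C0 True)
      next
        case False
        then have num': "num_factor g (n - 1) (2 * m) = 2 * g + real n + 2 * real m"
          "num_factor g (n - 1) k = 2 * real m + 2 - real n"
          using True by (simp_all add: k num_factor_def of_nat_diff)
        have "real n * num_prod g (n - 1) (Suc k) =
            num_prod g (n - 1) (2 * m) * (real n * (2 * g + real n + 2 * real m)) * (2 * real m + 2 - real n)"
          using num' by (simp add: num_prod_Suc k)
        also have "\<dots> = ?M * ((real n - 2 * real m) * (2 * g + real n)) * (2 * real m + 2 - real n)"
          using down False by simp
        also have "\<dots> = P * ((real n - 2 * real m - 2) * (2 * g + real n))"
          unfolding P_def k num_prod_Suc num(3) by algebra
        finally have "real n * (num_prod g (n - 1) (Suc k) - num_prod g n (Suc k)) =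
            - (P * ((2 * real m + 2) * (2 * v)))"
          by (simp add: num_prod_Suc[of g n k] num P_def[symmetric] v_def algebra_simps)
        moreover have "F2 = - ((real n - 2 * r1 - 2 * r2) / (4 * v)) *
           (real n * (num_prod g (n - 1) (Suc k) - num_prod g n (Suc k)))"
          using False by (simp add: F2_def C mult_ac)
        ultimately have "F2 = - ((real n - 2 * r1 - 2 * r2) / (4 * v)) * (- (P * ((2 * real m + 2) * (2 * v))))"
          by (simp only:)
        then show ?thesis
          by (simp only: mult_minus_left mult_minus_right quot_cancel[OF v[OF False]]; simp add: algebra_simps)
      qed
      show ?thesis
        unfolding split F1 F2 P_def[symmetric] num
        by (simp add: den_factor_def k g_def field_simps)
    qed
  next
    case False
    then have n: "n > 0" by (simp add: odd_pos)
    let ?M = "num_prod g n (2 * m)"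
    have A: "A = (real n + 1 + 2 * g) * (real n + 1 + 2 * \<rho>1 + 2 * \<rho>2) / (4 * u)"
      using False by (simp add: A_def BI_A_def Let_def g_def u_def)
    have C: "C = - ((real n - 2 * r2 + 2 * \<rho>2) * (real n - 2 * r1 + 2 * \<rho>2) / (4 * v))"
      using False n by (simp add: C_def BI_C_def Let_def g_def v_def)
    have down: "num_prod g (n - 1) (2 * m) = ?M"
      using num_prod_up_even[of "n - 1" g m] False n by simp
    note up = num_prod_up_odd[OF False, of g m]
    have FA: "F1 = (real n + 1 + 2 * \<rho>1 + 2 * \<rho>2) / (4 * u) *
        ((2 * g + real n + 1) * (num_prod g (Suc n) (Suc k) - num_prod g n (Suc k)))"
      by (simp add: F1_def A)
    show ?thesis
    proof (cases "k = 2 * m")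
      case k: True
      have num: "num_factor g n k = 2 * g + 1 + real n + 2 * real m"
        "num_factor g (Suc n) k = 2 * real m - real n - 1"
        "num_factor g (n - 1) k = 2 * real m - real n + 1"
        using False n by (simp_all add: k num_factor_def of_nat_diff)
      have "(2 * g + real n + 1) * num_prod g (Suc n) (Suc k) =
          - (num_prod g (Suc n) (2 * m) * ((real n + 1 - 2 * real m) * (2 * g + real n + 1)))"
        unfolding num_prod_Suc num k[symmetric] by algebra
      also have "\<dots> = - (P * ((real n + 1) * (2 * g + real n + 1 + 2 * real m)))"
        by (simp only: up[symmetric] P_def k)
      finally have "(2 * g + real n + 1) * (num_prod g (Suc n) (Suc k) - num_prod g n (Suc k)) =
          - (P * ((2 * g + 1 + real n + 2 * real m) * (2 * u)))"
        by (simp add: num_prod_Suc[of g n k] num P_def[symmetric] u_def algebra_simps)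
      then have F1: "F1 = P * (- ((real n + 1 + 2 * \<rho>1 + 2 * \<rho>2) * (2 * g + 1 + real n + 2 * real m) / 2))"
        unfolding FA by (simp only: mult_minus_right quot_cancel[OF u]; simp add: algebra_simps)
      have "F2 = C * (P * (- 1 * (2 * v)))"
        unfolding F2_def num_prod_Suc num down[folded k] P_def[symmetric] v_def by algebra
      then have F2: "F2 = P * ((real n - 2 * r2 + 2 * \<rho>2) * (real n - 2 * r1 + 2 * \<rho>2) / 2)"
        using n by (simp only: C mult_minus_left[of _ "P * _"] quot_cancel[OF v]; simp)
      show ?thesis
        unfolding split F1 F2 P_def[symmetric] num
        by (simp add: den_factor_def k g_def field_simps)
    next
      case nk: False
      then have k: "k = Suc (2 * m)" using m by blast
      have num: "num_factor g n k = 2 * real m + 1 - real n"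
        "num_factor g (Suc n) k = 2 * g + 3 + real n + 2 * real m"
        "num_factor g n (2 * m) = 2 * g + 1 + real n + 2 * real m"
        "num_factor g (Suc n) (2 * m) = 2 * real m - real n - 1"
        "num_factor g (n - 1) k = 2 * g + 1 + real n + 2 * real m"
        "num_factor g (n - 1) (2 * m) = 2 * real m - real n + 1"
        using False n by (simp_all add: k num_factor_def of_nat_diff)
      have "(2 * g + real n + 1) * num_prod g (Suc n) (Suc k) =
          - (num_prod g (Suc n) (2 * m) * ((real n + 1 - 2 * real m) * (2 * g + real n + 1)))
            * (2 * g + 3 + real n + 2 * real m)"
        unfolding num_prod_Suc[of g "Suc n" k] num unfolding k num_prod_Suc num by algebra
      also have "\<dots> = - (?M * ((real n + 1) * (2 * g + real n + 1 + 2 * real m)))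
            * (2 * g + 3 + real n + 2 * real m)"
        by (simp only: up[symmetric])
      also have "\<dots> = - (P * ((real n + 1) * (2 * g + 3 + real n + 2 * real m)))"
        unfolding P_def k num_prod_Suc num(3) by algebra
      finally have "(2 * g + real n + 1) * (num_prod g (Suc n) (Suc k) - num_prod g n (Suc k)) =
          - (P * ((2 * real m + 2) * (2 * u)))"
        by (simp add: num_prod_Suc[of g n k] num P_def[symmetric] u_def algebra_simps)
      then have F1: "F1 = P * (- ((real n + 1 + 2 * \<rho>1 + 2 * \<rho>2) * (real m + 1)))"
        unfolding FA by (simp only: mult_minus_right quot_cancel[OF u]; simp add: algebra_simps)
      have "num_prod g (n - 1) (Suc k) = num_prod g n (Suc k)"
        unfolding num_prod_Suc num unfolding k num_prod_Suc num down by simp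
      then have F2: "F2 = 0" by (simp add: F2_def)
      show ?thesis
        unfolding split F1 F2 P_def[symmetric] num
        by (simp add: den_factor_def k g_def field_simps)
    qed
  qed
qed

section \<open>Degree and recurrence of the limiting polynomials\<close>

lemma poly_lin: "poly (lin_factor \<rho>1 j) y = 2 * \<rho>1 + 1/2 + real j - 2 * (- 1) ^ j * y"
  by (simp add: lin_factor_def)

lemma lin_nonzero: "lin_factor \<rho>1 j \<noteq> 0"
  by (simp add: lin_factor_def)

lemma degree_lin: "degree (lin_factor \<rho>1 j) = 1"
  by (simp add: lin_factor_def)

lemma degree_newton: "degree (\<Prod>j<k. lin_factor \<rho>1 j) = k"
  by (subst degree_prod_sum_eq) (simp_all add: degree_lin lin_nonzero)

lemma coeff_newton_top: "coeff (\<Prod>j<k. lin_factor \<rho>1 j) k \<noteq> 0"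
  using leading_coeff_0_iff[of "\<Prod>j<k. lin_factor \<rho>1 j"] by (simp add: degree_newton lin_nonzero)

text \<open>
  The factor \<open>j = n\<close> of the numerator is zero. All coefficients beyond the \<open>n\<close>-th vanish,
  even where \<open>den_factor\<close> does, so neighbouring polynomials can be expanded over a common range.
\<close>

lemma lim_coeff_eq_0: "n < k \<Longrightarrow> lim_coeff r1 r2 \<rho>1 \<rho>2 n k = 0"
  by (simp add: lim_coeff_def num_prod_eq_0)

lemma lim_coeff_0 [simp]: "lim_coeff r1 r2 \<rho>1 \<rho>2 n 0 = 1"
  by (simp add: lim_coeff_def)

lemma poly_lim_poly:
  assumes "n \<le> K"
  shows "poly (lim_poly r1 r2 \<rho>1 \<rho>2 n) y =
    (\<Sum>k\<le>K. lim_coeff r1 r2 \<rho>1 \<rho>2 n k * (\<Prod>j<k. poly (lin_factor \<rho>1 j) y))"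
proof -
  have "poly (lim_poly r1 r2 \<rho>1 \<rho>2 n) y =
    (\<Sum>k\<le>n. lim_coeff r1 r2 \<rho>1 \<rho>2 n k * (\<Prod>j<k. poly (lin_factor \<rho>1 j) y))"
    by (simp add: lim_poly_def poly_sum poly_prod)
  also have "\<dots> = (\<Sum>k\<le>K. lim_coeff r1 r2 \<rho>1 \<rho>2 n k * (\<Prod>j<k. poly (lin_factor \<rho>1 j) y))"
    by (rule sum.mono_neutral_left) (use assms in \<open>auto simp: lim_coeff_eq_0\<close>)
  finally show ?thesis .
qed

text \<open>
  For odd \<open>n + j = 2 m + 1\<close> the numerator factor is \<open>2 (g + m + 1)\<close>: this is where the
  hypothesis on \<open>g\<close> enters.
\<close>

lemma lim_poly_top:
  assumes g: "\<And>k::nat. k \<ge> 1 \<Longrightarrow> \<rho>1 + \<rho>2 - r1 - r2 \<noteq> - real k"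
    and den: "\<And>j. j < n \<Longrightarrow> den_factor r1 r2 \<rho>1 \<rho>2 j \<noteq> 0"
  shows "degree (lim_poly r1 r2 \<rho>1 \<rho>2 n) = n" "coeff (lim_poly r1 r2 \<rho>1 \<rho>2 n) n \<noteq> 0"
proof -
  let ?R = "lim_poly r1 r2 \<rho>1 \<rho>2 n"
  have num: "num_factor (\<rho>1 + \<rho>2 - r1 - r2) n j \<noteq> 0" if "j < n" for j
  proof (cases "even (n + j)")
    case True
    then show ?thesis using that by (simp add: num_factor_def)
  next
    case False
    then obtain m where "n + j = 2 * m + 1" by (elim oddE)
    then have m: "real n + real j = 2 * real m + 1"
      by (metis of_nat_1 of_nat_add of_nat_mult of_nat_numeral)
    show ?thesis using g[of "Suc m"] m False by (simp add: num_factor_def)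
  qed
  have "coeff ?R n = (\<Sum>k\<le>n. lim_coeff r1 r2 \<rho>1 \<rho>2 n k * coeff (\<Prod>j<k. lin_factor \<rho>1 j) n)"
    by (simp add: lim_poly_def coeff_sum)
  also have "\<dots> = lim_coeff r1 r2 \<rho>1 \<rho>2 n n * coeff (\<Prod>j<n. lin_factor \<rho>1 j) n"
    by (subst sum.mono_neutral_right[of "{..n}" "{n}"]) (auto intro!: coeff_eq_0 simp: degree_newton)
  also have "\<dots> \<noteq> 0"
    using num den by (simp add: lim_coeff_def num_prod_def coeff_newton_top)
  finally show top: "coeff ?R n \<noteq> 0" .
  have "degree ?R \<le> n"
    unfolding lim_poly_def
    by (rule degree_sum_le) (auto intro: order_trans[OF degree_smult_le] simp: degree_newton)
  then show "degree ?R = n"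
    using le_degree[OF top] by simp
qed

text \<open>
  At \<open>n = 0\<close> the truncated \<open>n - 1\<close> is harmless because \<open>C\<close> vanishes there. The denominators are
  needed up to \<open>j = n\<close>, the last one that occurs in the polynomial of index \<open>n + 1\<close>.
\<close>

lemma lim_poly_recurrence:
  fixes r1 r2 \<rho>1 \<rho>2 :: real and n :: nat
  defines "A \<equiv> BI_A r1 r2 \<rho>1 \<rho>2 n" and "C \<equiv> BI_C r1 r2 \<rho>1 \<rho>2 n"
    and "R \<equiv> lim_poly r1 r2 \<rho>1 \<rho>2"
  assumes g: "\<And>k::nat. k \<ge> 1 \<Longrightarrow> \<rho>1 + \<rho>2 - r1 - r2 \<noteq> - real k"
    and den: "\<And>j. j < Suc n \<Longrightarrow> den_factor r1 r2 \<rho>1 \<rho>2 j \<noteq> 0"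
  shows "A * poly (R (Suc n)) y + (1/4 + \<rho>1 - A - C) * poly (R n) y + C * poly (R (n - 1)) y
    = y * poly (R n) y"
proof -
  define \<Phi> where "\<Phi> k = (\<Prod>j<k. poly (lin_factor \<rho>1 j) y)" for k
  define e where "e = lim_coeff r1 r2 \<rho>1 \<rho>2"
  define w where "w k = 2 * \<rho>1 + 1/2 + real k" for k
  have R: "poly (R m) y = (\<Sum>k\<le>Suc n. e m k * \<Phi> k)" if "m \<le> Suc n" for m
    unfolding R_def e_def \<Phi>_def by (rule poly_lim_poly[OF that])
  have e0: "e m 0 = 1" for m by (simp add: e_def)
  have y\<Phi>: "y * \<Phi> k = (- 1) ^ k / 2 * (w k * \<Phi> k - \<Phi> (Suc k))" for k
    by (cases "even k") (simp_all add: \<Phi>_def w_def poly_lin field_simps)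
  have coeff: "A * e (Suc n) (Suc k) + (1/4 + \<rho>1 - A - C) * e n (Suc k) + C * e (n - 1) (Suc k)
      = (- 1) ^ Suc k / 2 * w (Suc k) * e n (Suc k) - (- 1) ^ k / 2 * e n k" if "k \<le> n" for k
  proof -
    let ?g = "\<rho>1 + \<rho>2 - r1 - r2" and ?s = "(- 1) ^ k :: real"
    define E where "E = ?s * (\<Prod>j<Suc k. den_factor r1 r2 \<rho>1 \<rho>2 j)"
    have dk: "den_factor r1 r2 \<rho>1 \<rho>2 k \<noteq> 0" using den that by simp
    have E: "E \<noteq> 0" using den that by (simp add: E_def)
    have s: "?s * ?s = 1" by (simp flip: power_add)
    have eS: "e m (Suc k) = - num_prod ?g m (Suc k) / E" for m
      by (cases "even k") (simp_all add: e_def lim_coeff_def E_def)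
    have ek: "e n k = den_factor r1 r2 \<rho>1 \<rho>2 k * num_prod ?g n k / E"
      using dk by (cases "even k") (simp_all add: e_def lim_coeff_def E_def)
    have "A * num_prod ?g (Suc n) (Suc k) + (1/4 + \<rho>1 - A - C) * num_prod ?g n (Suc k)
        + C * num_prod ?g (n - 1) (Suc k)
      = ?s / 2 * den_factor r1 r2 \<rho>1 \<rho>2 k * num_prod ?g n k - ?s * w (Suc k) / 2 * num_prod ?g n (Suc k)"
      using num_prod_recurrence[of \<rho>1 \<rho>2 r1 r2 n k, OF g]
      unfolding A_def C_def w_def by (simp add: algebra_simps)
    \<comment> \<open>Passing from products to coefficients is division by the common denominator, up to sign.\<close>
    note arg_cong[where f = "\<lambda>t. - t / E", OF this]
    then show ?thesis
      unfolding eS ek by (simp add: add_divide_distrib diff_divide_distrib algebra_simps)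
  qed
  have "y * poly (R n) y = (\<Sum>k\<le>Suc n. e n k * (y * \<Phi> k))"
    by (simp add: R sum_distrib_left mult_ac del: sum.atMost_Suc)
  also have "\<dots> = (\<Sum>k\<le>Suc n. (- 1) ^ k / 2 * w k * e n k * \<Phi> k)
      - (\<Sum>k\<le>Suc n. (- 1) ^ k / 2 * e n k * \<Phi> (Suc k))"
    unfolding y\<Phi> sum_subtractf[symmetric] by (intro sum.cong refl) (simp add: algebra_simps)
  \<comment> \<open>The last coefficient is zero; dropping it lets both sums be indexed by \<open>\<Phi> (Suc k)\<close>.\<close>
  also have "(\<Sum>k\<le>Suc n. (- 1) ^ k / 2 * e n k * \<Phi> (Suc k)) = (\<Sum>k\<le>n. (- 1) ^ k / 2 * e n k * \<Phi> (Suc k))"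
    by (simp add: e_def lim_coeff_eq_0)
  also have "(\<Sum>k\<le>Suc n. (- 1) ^ k / 2 * w k * e n k * \<Phi> k) =
      w 0 / 2 * \<Phi> 0 + (\<Sum>k\<le>n. (- 1) ^ Suc k / 2 * w (Suc k) * e n (Suc k) * \<Phi> (Suc k))"
    by (subst sum.atMost_Suc_shift) (simp add: e0)
  also have "\<dots> - (\<Sum>k\<le>n. (- 1) ^ k / 2 * e n k * \<Phi> (Suc k)) =
      w 0 / 2 * \<Phi> 0 + (\<Sum>k\<le>n. ((- 1) ^ Suc k / 2 * w (Suc k) * e n (Suc k) - (- 1) ^ k / 2 * e n k) * \<Phi> (Suc k))"
    by (simp add: sum_subtractf left_diff_distrib)
  also have "\<dots> = (A + (1/4 + \<rho>1 - A - C) + C) * \<Phi> 0 + (\<Sum>k\<le>n. (A * e (Suc n) (Suc k)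
      + (1/4 + \<rho>1 - A - C) * e n (Suc k) + C * e (n - 1) (Suc k)) * \<Phi> (Suc k))"
  proof -
    have "w 0 / 2 = A + (1/4 + \<rho>1 - A - C) + C"
      by (simp add: w_def)
    then show ?thesis
      by (auto simp only: coeff atMost_iff intro!: arg_cong2[where f = "(+)"] sum.cong)
  qed
  also have "\<dots> = (\<Sum>k\<le>Suc n. (A * e (Suc n) k
      + (1/4 + \<rho>1 - A - C) * e n k + C * e (n - 1) k) * \<Phi> k)"
    by (subst sum.atMost_Suc_shift) (simp add: e0)
  also have "\<dots> = A * poly (R (Suc n)) y + (1/4 + \<rho>1 - A - C) * poly (R n) y + C * poly (R (n - 1)) y"
    by (simp add: R sum_distrib_left sum.distrib distrib_right mult.assoc del: sum.atMost_Suc)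
  finally show ?thesis ..
qed

text \<open>Compare the coefficients of \<open>y\<^bsup>n+1\<^esup>\<close> in the recurrence.\<close>

lemma lim_poly_lead:
  fixes r1 r2 \<rho>1 \<rho>2 :: real
  defines "R \<equiv> lim_poly r1 r2 \<rho>1 \<rho>2"
  assumes g: "\<And>k::nat. k \<ge> 1 \<Longrightarrow> \<rho>1 + \<rho>2 - r1 - r2 \<noteq> - real k"
    and den: "\<And>j. j < Suc n \<Longrightarrow> den_factor r1 r2 \<rho>1 \<rho>2 j \<noteq> 0"
  shows "BI_A r1 r2 \<rho>1 \<rho>2 n * lead_coeff (R (Suc n)) = lead_coeff (R n)"
proof -
  let ?A = "BI_A r1 r2 \<rho>1 \<rho>2 n" and ?C = "BI_C r1 r2 \<rho>1 \<rho>2 n"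
  have deg: "degree (R m) = m" if "m \<le> Suc n" for m
    unfolding R_def by (rule lim_poly_top(1)[OF g]) (use den that in auto)
  have "smult ?A (R (Suc n)) + smult (1/4 + \<rho>1 - ?A - ?C) (R n) + smult ?C (R (n - 1)) = [:0, 1:] * R n"
    using lim_poly_recurrence[OF g den]
    by (intro poly_eq_poly_eq_iff[THEN iffD1] ext) (simp add: R_def)
  note arg_cong[where f = "\<lambda>p. coeff p (Suc n)", OF this]
  then show ?thesis
    by (simp add: deg coeff_eq_0)
qed

section \<open>Identification with the Bannai-Ito polynomials\<close>

text \<open>
  Dividing the recurrence by the leading coefficient \<open>\<kappa>\<^sub>n\<close> and using \<open>A\<^sub>n \<kappa>\<^bsub>n+1\<^esub> = \<kappa>\<^sub>n\<close>, the coefficient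
  of the top term becomes \<open>1\<close> and \<open>C\<^sub>n\<close> becomes \<open>A\<^bsub>n-1\<^esub> C\<^sub>n\<close>; the constant \<open>1/4\<close> is absorbed by the
  shift of the argument.
\<close>

lemma lim_poly_bannai_ito:
  fixes r1 r2 \<rho>1 \<rho>2 :: real
  defines "R \<equiv> lim_poly r1 r2 \<rho>1 \<rho>2"
  assumes g: "\<And>k::nat. k \<ge> 1 \<Longrightarrow> \<rho>1 + \<rho>2 - r1 - r2 \<noteq> - real k"
    and den: "\<And>j. j < n \<Longrightarrow> den_factor r1 r2 \<rho>1 \<rho>2 j \<noteq> 0"
  shows "poly (R n) y = lead_coeff (R n) * poly (bannai_ito r1 r2 \<rho>1 \<rho>2 n) (y - 1/4)"
  using den
proof (induction n rule: less_induct)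
  case (less n)
  let ?A = "BI_A r1 r2 \<rho>1 \<rho>2" and ?C = "BI_C r1 r2 \<rho>1 \<rho>2"
  let ?P = "\<lambda>n. poly (bannai_ito r1 r2 \<rho>1 \<rho>2 n) (y - 1/4)"
  note rec = lim_poly_recurrence[where y = y, OF g, folded R_def]
  note lead = lim_poly_lead[OF g, folded R_def]
  have R0: "R 0 = 1" by (simp add: R_def lim_poly_def)
  have nz: "lead_coeff (R m) \<noteq> 0" if "m \<le> n" for m
    using lim_poly_top[OF g, where n = m] less.prems that by (simp add: R_def)
  show ?case
  proof (cases n)
    case 0
    then show ?thesis by (simp add: R0)
  next
    case (Suc n')
    have l: "?A n' * lead_coeff (R n) = lead_coeff (R n')"
      using lead[of n'] less.prems Suc by simp
    have A: "?A n' \<noteq> 0" using l nz[of n'] Suc by auto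
    have r: "?A n' * poly (R n) y =
        (y - (1/4 + \<rho>1 - ?A n' - ?C n')) * poly (R n') y - ?C n' * poly (R (n' - 1)) y"
      using rec[of n'] less.prems Suc by (simp add: algebra_simps)
    have "?A n' * poly (R n) y = ?A n' * (lead_coeff (R n) * ?P n)"
    proof (cases n')
      case 0
      have "?C 0 = 0" by (simp add: BI_C_def)
      then show ?thesis
        using r l Suc 0 by (simp add: R0 algebra_simps)
    next
      case (Suc n'')
      have l': "?A n'' * lead_coeff (R n') = lead_coeff (R n'')"
        using lead[of n''] less.prems \<open>n = Suc n'\<close> Suc by simp
      have pred: "n' - 1 = n''" using Suc by simp
      have IH: "poly (R n') y = lead_coeff (R n') * ?P n'" "poly (R n'') y = lead_coeff (R n'') * ?P n''"
        using less.IH less.prems \<open>n = Suc n'\<close> Suc by auto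
      have P: "?P n = (y - 1/4 - (\<rho>1 - ?A n' - ?C n')) * ?P n' - ?A n'' * ?C n' * ?P n''"
        by (simp add: \<open>n = Suc n'\<close> Suc algebra_simps)
      have "?A n' * poly (R n) y = (y - (1/4 + \<rho>1 - ?A n' - ?C n')) * (lead_coeff (R n') * ?P n')
          - ?C n' * (?A n'' * lead_coeff (R n') * ?P n'')"
        using r by (simp only: pred IH l')
      also have "\<dots> = lead_coeff (R n') * ?P n"
        unfolding P by algebra
      finally show ?thesis using l by simp
    qed
    then show ?thesis using A by simp
  qed
qed

section \<open>The termwise limit\<close>

definition wave :: "nat \<Rightarrow> real \<Rightarrow> real \<Rightarrow> complex" where
  "wave m u \<epsilon> = 1 - (- 1) ^ m * complex_of_real (exp (\<epsilon> * u))"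

text \<open>The limit is minus the derivative of \<open>exp (\<epsilon> u)\<close> at \<open>\<epsilon> = 0\<close>.\<close>

lemma tendsto_wave_even:
  assumes "even m"
  shows "((\<lambda>\<epsilon>. wave m u \<epsilon> / complex_of_real \<epsilon>) \<longlongrightarrow> - complex_of_real u) (at 0)"
proof -
  have "((\<lambda>\<epsilon>. exp (\<epsilon> * u)) has_real_derivative u) (at 0)"
    by (auto intro!: derivative_eq_intros)
  then have "((\<lambda>\<epsilon>. (exp (\<epsilon> * u) - 1) / \<epsilon>) \<longlongrightarrow> u) (at 0)"
    by (simp add: DERIV_def)
  then have "((\<lambda>\<epsilon>. complex_of_real (- ((exp (\<epsilon> * u) - 1) / \<epsilon>))) \<longlongrightarrow> complex_of_real (- u)) (at 0)"
    by (intro tendsto_of_real tendsto_minus)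
  then show ?thesis
    using assms by (simp add: wave_def minus_divide_left)
qed

lemma tendsto_wave_odd:
  assumes "odd m"
  shows "(wave m u \<longlongrightarrow> 2) (at 0)"
proof -
  have "((\<lambda>\<epsilon>. 1 - (- 1) * complex_of_real (exp (\<epsilon> * u))) \<longlongrightarrow> 1 - (- 1) * complex_of_real (exp (0 * u))) (at 0)"
    by (intro tendsto_intros)
  then show ?thesis
    using assms by (simp add: wave_def[abs_def])
qed

text \<open>
  Exactly one factor of the pair vanishes at \<open>\<epsilon> = 0\<close>. Pairing makes the order of vanishing
  independent of the parity, so that the limit of the series terms needs no case distinction.
\<close>

lemma tendsto_wave_pair:
  assumes "odd (m + m')"
  shows "((\<lambda>\<epsilon>. wave m u \<epsilon> * wave m' u' \<epsilon> / complex_of_real \<epsilon>)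
           \<longlongrightarrow> complex_of_real (- 2 * (if even m then u else u'))) (at 0)"
proof (cases "even m")
  case True
  then have "((\<lambda>\<epsilon>. wave m u \<epsilon> / complex_of_real \<epsilon> * wave m' u' \<epsilon>) \<longlongrightarrow> - complex_of_real u * 2) (at 0)"
    using assms by (intro tendsto_mult tendsto_wave_even tendsto_wave_odd) auto
  then show ?thesis using True by (simp add: mult.commute)
next
  case False
  then have "((\<lambda>\<epsilon>. wave m u \<epsilon> * (wave m' u' \<epsilon> / complex_of_real \<epsilon>)) \<longlongrightarrow> 2 * - complex_of_real u') (at 0)"
    using assms by (intro tendsto_mult tendsto_wave_even tendsto_wave_odd) auto
  then show ?thesis using False by simp
qed

text \<open>The factor leading from the term of index \<open>j\<close> to that of index \<open>j + 1\<close> in the Askey-Wilson series.\<close>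

definition aw_factor ::
  "nat \<Rightarrow> complex \<Rightarrow> complex \<Rightarrow> complex \<Rightarrow> complex \<Rightarrow> complex \<Rightarrow> complex \<Rightarrow> nat \<Rightarrow> complex" where
  "aw_factor n a b c d q z j =
     (1 - q powi (- int n) * q ^ j) * (1 - a * b * c * d * q powi (int n - 1) * q ^ j) *
     (1 - a * z * q ^ j) * (1 - a * inverse z * q ^ j) /
     ((1 - a * b * q ^ j) * (1 - a * c * q ^ j) * (1 - a * d * q ^ j) * (1 - q * q ^ j)) * q"

lemma askey_wilson_sum:
  assumes "q \<noteq> 0"
  shows "askey_wilson n a b c d q z = (\<Sum>k\<le>n. \<Prod>j<k. aw_factor n a b c d q z j)"
proof -
  have zero: "qpoch (q powi (- int n)) q k = 0" if "n < k" for k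
    unfolding qpoch_def
    by (rule prod_zero) (use that assms in \<open>auto simp: power_int_minus intro!: bexI[of _ n]\<close>)
  have "askey_wilson n a b c d q z = (\<Sum>k\<le>n.
      qpoch (q powi (- int n)) q k * qpoch (a * b * c * d * q powi (int n - 1)) q k *
      qpoch (a * z) q k * qpoch (a * inverse z) q k /
      (qpoch (a * b) q k * qpoch (a * c) q k * qpoch (a * d) q k * qpoch q q k) * q ^ k)"
    unfolding askey_wilson_def Phi43_def
    by (rule suminf_finite) (auto simp: zero)
  also have "\<dots> = (\<Sum>k\<le>n. \<Prod>j<k. aw_factor n a b c d q z j)"
    by (simp add: qpoch_def aw_factor_def prod.distrib prod_dividef)
  finally show ?thesis .
qed

theorem mainTheorem13:
  fixes r1 r2 \<rho>1 \<rho>2 :: real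
    and q a b c d :: "real \<Rightarrow> complex"
    and z :: "real \<Rightarrow> real \<Rightarrow> complex"
  assumes g: "\<And>k::nat. k \<ge> 1 \<Longrightarrow> \<rho>1 + \<rho>2 - r1 - r2 \<noteq> - real k"
    and q: "\<And>\<epsilon>. q \<epsilon> = - complex_of_real (exp \<epsilon>)"
    and a: "\<And>\<epsilon>. a \<epsilon> = - \<i> * complex_of_real (exp (\<epsilon> * (2 * \<rho>1 + 1/2)))"
    and b: "\<And>\<epsilon>. b \<epsilon> = - \<i> * complex_of_real (exp (\<epsilon> * (2 * \<rho>2 + 1/2)))"
    and c: "\<And>\<epsilon>. c \<epsilon> = \<i> * complex_of_real (exp (\<epsilon> * (- 2 * r2 + 1/2)))"
    and d: "\<And>\<epsilon>. d \<epsilon> = \<i> * complex_of_real (exp (\<epsilon> * (- 2 * r1 + 1/2)))"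
    and z: "\<And>y \<epsilon>. z y \<epsilon> = \<i> * complex_of_real (exp (- 2 * \<epsilon> * y))"
  shows "\<exists>R :: nat \<Rightarrow> real poly.
    (\<forall>n. (\<forall>\<^sub>F \<epsilon> in at 0. askey_wilson_defined n (a \<epsilon>) (b \<epsilon>) (c \<epsilon>) (d \<epsilon>) (q \<epsilon>)) \<longrightarrow>
      degree (R n) = n \<and>
      (\<forall>y. ((\<lambda>\<epsilon>. askey_wilson n (a \<epsilon>) (b \<epsilon>) (c \<epsilon>) (d \<epsilon>) (q \<epsilon>) (z y \<epsilon>))
              \<longlongrightarrow> complex_of_real (poly (R n) y)) (at 0)) \<and>
      (\<forall>y. poly (monic_version (R n)) y = poly (bannai_ito r1 r2 \<rho>1 \<rho>2 n) (y - 1/4))) \<and>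
    (\<forall>n. (\<forall>\<^sub>F \<epsilon> in at 0. askey_wilson_defined (n + 1) (a \<epsilon>) (b \<epsilon>) (c \<epsilon>) (d \<epsilon>) (q \<epsilon>)) \<longrightarrow>
      (\<forall>y. BI_A r1 r2 \<rho>1 \<rho>2 n * poly (R (n + 1)) y
           + (1/4 + \<rho>1 - BI_A r1 r2 \<rho>1 \<rho>2 n - BI_C r1 r2 \<rho>1 \<rho>2 n) * poly (R n) y
           + BI_C r1 r2 \<rho>1 \<rho>2 n * poly (R (n - 1)) y
           = y * poly (R n) y))"
proof -
  let ?g = "\<rho>1 + \<rho>2 - r1 - r2"
  let ?R = "lim_poly r1 r2 \<rho>1 \<rho>2"
  let ?e = "\<lambda>u \<epsilon>. complex_of_real (exp (\<epsilon> * u))"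
  have e_mult: "?e u \<epsilon> * ?e v \<epsilon> = ?e (u + v) \<epsilon>" for u v \<epsilon>
    by (simp add: distrib_left exp_add)
  have wave: "wave m u \<epsilon> = 1 - (- 1) ^ m * ?e u \<epsilon>" for m u \<epsilon>
    by (simp add: wave_def)
  have q_nz: "q \<epsilon> \<noteq> 0" for \<epsilon> by (simp add: q)
  have q_pow: "q \<epsilon> ^ j = (- 1) ^ j * ?e (real j) \<epsilon>" for j \<epsilon>
    by (subst q, subst power_minus) (simp add: exp_of_nat2_mult)
  have q_inv: "inverse (q \<epsilon> ^ j) = (- 1) ^ j * ?e (- real j) \<epsilon>" for j \<epsilon>
    by (cases "even j") (simp_all add: q_pow exp_minus)
  \<comment> \<open>The eight factors of a term quotient as \<open>wave\<close>s: the sign and the exponent are read off.\<close>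
  have ab: "1 - a \<epsilon> * b \<epsilon> * q \<epsilon> ^ j = wave (Suc j) (2 * \<rho>1 + 2 * \<rho>2 + 1 + real j) \<epsilon>" for \<epsilon> j
  proof -
    have "a \<epsilon> * b \<epsilon> * q \<epsilon> ^ j = (- 1) ^ Suc j * (?e (2 * \<rho>1 + 1/2) \<epsilon> * ?e (2 * \<rho>2 + 1/2) \<epsilon> * ?e (real j) \<epsilon>)"
      unfolding a b q_pow by (simp add: mult_ac)
    then show ?thesis unfolding wave e_mult by (simp add: algebra_simps)
  qed
  have ac: "1 - a \<epsilon> * c \<epsilon> * q \<epsilon> ^ j = wave j (2 * \<rho>1 - 2 * r2 + 1 + real j) \<epsilon>" for \<epsilon> j
  proof -
    have "a \<epsilon> * c \<epsilon> * q \<epsilon> ^ j = (- 1) ^ j * (?e (2 * \<rho>1 + 1/2) \<epsilon> * ?e (- 2 * r2 + 1/2) \<epsilon> * ?e (real j) \<epsilon>)"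
      unfolding a c q_pow by (simp add: mult_ac)
    then show ?thesis unfolding wave e_mult by (simp add: algebra_simps)
  qed
  have ad: "1 - a \<epsilon> * d \<epsilon> * q \<epsilon> ^ j = wave j (2 * \<rho>1 - 2 * r1 + 1 + real j) \<epsilon>" for \<epsilon> j
  proof -
    have "a \<epsilon> * d \<epsilon> * q \<epsilon> ^ j = (- 1) ^ j * (?e (2 * \<rho>1 + 1/2) \<epsilon> * ?e (- 2 * r1 + 1/2) \<epsilon> * ?e (real j) \<epsilon>)"
      unfolding a d q_pow by (simp add: mult_ac)
    then show ?thesis unfolding wave e_mult by (simp add: algebra_simps)
  qed
  have qq: "1 - q \<epsilon> * q \<epsilon> ^ j = wave (Suc j) (real j + 1) \<epsilon>" for \<epsilon> j
    using q_pow[of \<epsilon> "Suc j"] by (simp add: wave add.commute)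
  have qn: "1 - q \<epsilon> powi (- int n) * q \<epsilon> ^ j = wave (n + j) (real j - real n) \<epsilon>" for \<epsilon> n j
  proof -
    have "q \<epsilon> powi (- int n) * q \<epsilon> ^ j = (- 1) ^ (n + j) * (?e (- real n) \<epsilon> * ?e (real j) \<epsilon>)"
      unfolding power_int_minus power_int_of_nat q_inv by (simp add: q_pow power_add)
    then show ?thesis unfolding wave e_mult by (simp add: algebra_simps)
  qed
  have abcd: "1 - a \<epsilon> * b \<epsilon> * c \<epsilon> * d \<epsilon> * q \<epsilon> powi (int n - 1) * q \<epsilon> ^ j =
      wave (Suc (n + j)) (2 * ?g + 1 + real n + real j) \<epsilon>" for \<epsilon> n j
  proof -
    have "q \<epsilon> powi (int n - 1) = q \<epsilon> ^ n * inverse (q \<epsilon> ^ 1)"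
      using q_nz by (simp add: power_int_diff field_simps)
    then have "a \<epsilon> * b \<epsilon> * c \<epsilon> * d \<epsilon> * q \<epsilon> powi (int n - 1) * q \<epsilon> ^ j = (- 1) ^ Suc (n + j) *
        (?e (2 * \<rho>1 + 1/2) \<epsilon> * ?e (2 * \<rho>2 + 1/2) \<epsilon> * ?e (- 2 * r2 + 1/2) \<epsilon> * ?e (- 2 * r1 + 1/2) \<epsilon>
          * ?e (real n) \<epsilon> * ?e (- real 1) \<epsilon> * ?e (real j) \<epsilon>)"
      unfolding q_inv unfolding a b c d q_pow by (simp add: mult_ac power_add)
    then show ?thesis unfolding wave e_mult by (simp add: algebra_simps)
  qed
  have az: "1 - a \<epsilon> * z y \<epsilon> * q \<epsilon> ^ j = wave j (2 * \<rho>1 + 1/2 + real j - 2 * y) \<epsilon>" for \<epsilon> y j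
  proof -
    have "z y \<epsilon> = \<i> * ?e (- 2 * y) \<epsilon>" by (simp add: z mult_ac)
    then have "a \<epsilon> * z y \<epsilon> * q \<epsilon> ^ j = (- 1) ^ j * (?e (2 * \<rho>1 + 1/2) \<epsilon> * ?e (- 2 * y) \<epsilon> * ?e (real j) \<epsilon>)"
      unfolding a q_pow by (simp add: mult_ac)
    then show ?thesis unfolding wave e_mult by (simp add: algebra_simps)
  qed
  have az': "1 - a \<epsilon> * inverse (z y \<epsilon>) * q \<epsilon> ^ j = wave (Suc j) (2 * \<rho>1 + 1/2 + real j + 2 * y) \<epsilon>" for \<epsilon> y j
  proof -
    have "inverse (z y \<epsilon>) = - \<i> * ?e (2 * y) \<epsilon>"
      by (simp add: z mult_ac exp_minus)
    then have "a \<epsilon> * inverse (z y \<epsilon>) * q \<epsilon> ^ j =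
        (- 1) ^ Suc j * (?e (2 * \<rho>1 + 1/2) \<epsilon> * ?e (2 * y) \<epsilon> * ?e (real j) \<epsilon>)"
      unfolding a q_pow by (simp add: mult_ac)
    then show ?thesis unfolding wave e_mult by (simp add: algebra_simps)
  qed
  note waves = ab ac ad qq qn abcd az az'

  \<comment> \<open>A zero of \<open>den_factor\<close> makes the corresponding factor of the series vanish identically in \<open>\<epsilon>\<close>.\<close>
  have den_nz: "den_factor r1 r2 \<rho>1 \<rho>2 j \<noteq> 0"
    if defd: "\<forall>\<^sub>F \<epsilon> in at 0. askey_wilson_defined n (a \<epsilon>) (b \<epsilon>) (c \<epsilon>) (d \<epsilon>) (q \<epsilon>)" and j: "j < n"
    for n j
  proof
    assume 0: "den_factor r1 r2 \<rho>1 \<rho>2 j = 0"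
    obtain \<epsilon> where "askey_wilson_defined n (a \<epsilon>) (b \<epsilon>) (c \<epsilon>) (d \<epsilon>) (q \<epsilon>)"
      using eventually_happens[OF defd] by auto
    then have "qpoch (a \<epsilon> * b \<epsilon>) (q \<epsilon>) n \<noteq> 0" "qpoch (a \<epsilon> * c \<epsilon>) (q \<epsilon>) n \<noteq> 0" "qpoch (a \<epsilon> * d \<epsilon>) (q \<epsilon>) n \<noteq> 0"
      unfolding askey_wilson_defined_def by auto
    then have nz: "wave (Suc j) (2 * \<rho>1 + 2 * \<rho>2 + 1 + real j) \<epsilon> \<noteq> 0"
      "wave j (2 * \<rho>1 - 2 * r2 + 1 + real j) \<epsilon> \<noteq> 0" "wave j (2 * \<rho>1 - 2 * r1 + 1 + real j) \<epsilon> \<noteq> 0"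
      using j unfolding qpoch_def waves by auto
    have wave0: "wave m 0 \<epsilon> = 0" if "even m" for m
      using that by (simp add: wave_def)
    show False
    proof (cases "even j")
      case True
      with 0 consider "2 * \<rho>1 - 2 * r2 + 1 + real j = 0" | "2 * \<rho>1 - 2 * r1 + 1 + real j = 0"
        by (auto simp: den_factor_def)
      then show False using nz wave0[OF True] by cases auto
    next
      case False
      with 0 have "2 * \<rho>1 + 2 * \<rho>2 + 1 + real j = 0"
        by (auto simp: den_factor_def)
      then show False using nz(1) wave0[of "Suc j"] False by auto
    qed
  qed

  have factor_lim: "((\<lambda>\<epsilon>. aw_factor n (a \<epsilon>) (b \<epsilon>) (c \<epsilon>) (d \<epsilon>) (q \<epsilon>) (z y \<epsilon>) j) \<longlongrightarrow>
      complex_of_real (- (num_factor ?g n j * poly (lin_factor \<rho>1 j) y / den_factor r1 r2 \<rho>1 \<rho>2 j))) (at 0)"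
    if den: "den_factor r1 r2 \<rho>1 \<rho>2 j \<noteq> 0" for n y j
  proof -
    \<comment> \<open>Dividing each of the two pairs above and the two below by \<open>\<epsilon>\<close> does not change the fraction.\<close>
    let ?pair = "\<lambda>m m' u u' \<epsilon>. wave m u \<epsilon> * wave m' u' \<epsilon> / complex_of_real \<epsilon>"
    let ?N1 = "?pair (n + j) (Suc (n + j)) (real j - real n) (2 * ?g + 1 + real n + real j)"
    let ?N2 = "?pair j (Suc j) (2 * \<rho>1 + 1/2 + real j - 2 * y) (2 * \<rho>1 + 1/2 + real j + 2 * y)"
    let ?D1 = "?pair j (Suc j) (2 * \<rho>1 - 2 * r2 + 1 + real j) (2 * \<rho>1 + 2 * \<rho>2 + 1 + real j)"
    let ?D2 = "?pair j (Suc j) (2 * \<rho>1 - 2 * r1 + 1 + real j) (real j + 1)"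
    let ?d1 = "if even j then 2 * \<rho>1 - 2 * r2 + 1 + real j else 2 * \<rho>1 + 2 * \<rho>2 + 1 + real j"
    let ?d2 = "if even j then 2 * \<rho>1 - 2 * r1 + 1 + real j else real j + 1"
    have d: "?d1 * ?d2 = den_factor r1 r2 \<rho>1 \<rho>2 j"
      by (simp add: den_factor_def)
    have l: "(if even j then 2 * \<rho>1 + 1/2 + real j - 2 * y else 2 * \<rho>1 + 1/2 + real j + 2 * y) = poly (lin_factor \<rho>1 j) y"
      by (simp add: poly_lin)
    have q_lim: "(q \<longlongrightarrow> - 1) (at 0)"
    proof -
      have "((\<lambda>\<epsilon>. - complex_of_real (exp \<epsilon>)) \<longlongrightarrow> - complex_of_real (exp 0)) (at 0)"
        by (intro tendsto_intros)
      then show ?thesis by (simp flip: q)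
    qed
    have N1: "(?N1 \<longlongrightarrow> complex_of_real (- 2 * num_factor ?g n j)) (at 0)"
      unfolding num_factor_def by (rule tendsto_wave_pair) simp
    have N2: "(?N2 \<longlongrightarrow> complex_of_real (- 2 * poly (lin_factor \<rho>1 j) y)) (at 0)"
      unfolding l[symmetric] by (rule tendsto_wave_pair) simp
    have D1: "(?D1 \<longlongrightarrow> complex_of_real (- 2 * ?d1)) (at 0)"
      by (rule tendsto_wave_pair) simp
    have D2: "(?D2 \<longlongrightarrow> complex_of_real (- 2 * ?d2)) (at 0)"
      by (rule tendsto_wave_pair) simp
    have "complex_of_real (- 2 * ?d1) * complex_of_real (- 2 * ?d2) \<noteq> 0"
      using den unfolding d[symmetric] by simp
    then have lim: "((\<lambda>\<epsilon>. ?N1 \<epsilon> * ?N2 \<epsilon> / (?D1 \<epsilon> * ?D2 \<epsilon>) * q \<epsilon>) \<longlongrightarrow>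
        complex_of_real (- 2 * num_factor ?g n j) * complex_of_real (- 2 * poly (lin_factor \<rho>1 j) y) /
        (complex_of_real (- 2 * ?d1) * complex_of_real (- 2 * ?d2)) * (- 1)) (at 0)"
      by (intro tendsto_mult tendsto_divide N1 N2 D1 D2 q_lim)
    have val: "complex_of_real (- 2 * num_factor ?g n j) * complex_of_real (- 2 * poly (lin_factor \<rho>1 j) y) /
        (complex_of_real (- 2 * ?d1) * complex_of_real (- 2 * ?d2)) * (- 1)
      = complex_of_real (- (num_factor ?g n j * poly (lin_factor \<rho>1 j) y / den_factor r1 r2 \<rho>1 \<rho>2 j))"
      unfolding d[symmetric] by (simp del: of_real_add of_real_diff)
    have "\<forall>\<^sub>F \<epsilon> in at (0::real). \<epsilon> \<noteq> 0"
      by (rule eventually_neq_at_within)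
    then have "\<forall>\<^sub>F \<epsilon> in at 0. ?N1 \<epsilon> * ?N2 \<epsilon> / (?D1 \<epsilon> * ?D2 \<epsilon>) * q \<epsilon> =
        aw_factor n (a \<epsilon>) (b \<epsilon>) (c \<epsilon>) (d \<epsilon>) (q \<epsilon>) (z y \<epsilon>) j"
      unfolding aw_factor_def waves
      by eventually_elim (simp add: divide_simps mult_ac)
    from Lim_transform_eventually[OF lim this] show ?thesis
      unfolding val .
  qed

  have aw_lim: "((\<lambda>\<epsilon>. askey_wilson n (a \<epsilon>) (b \<epsilon>) (c \<epsilon>) (d \<epsilon>) (q \<epsilon>) (z y \<epsilon>)) \<longlongrightarrow>
      complex_of_real (poly (?R n) y)) (at 0)"
    if den: "\<And>j. j < n \<Longrightarrow> den_factor r1 r2 \<rho>1 \<rho>2 j \<noteq> 0" for n y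
  proof -
    have coeff: "lim_coeff r1 r2 \<rho>1 \<rho>2 n k * (\<Prod>j<k. poly (lin_factor \<rho>1 j) y) =
        (\<Prod>j<k. - (num_factor ?g n j * poly (lin_factor \<rho>1 j) y / den_factor r1 r2 \<rho>1 \<rho>2 j))" for k
    proof (induction k)
      case 0
      then show ?case by simp
    next
      case (Suc k)
      show ?case
        unfolding prod.lessThan_Suc Suc.IH[symmetric]
        by (simp add: lim_coeff_def num_prod_Suc mult_ac)
    qed
    have "((\<lambda>\<epsilon>. \<Sum>k\<le>n. \<Prod>j<k. aw_factor n (a \<epsilon>) (b \<epsilon>) (c \<epsilon>) (d \<epsilon>) (q \<epsilon>) (z y \<epsilon>) j) \<longlongrightarrow>
      (\<Sum>k\<le>n. \<Prod>j<k. complex_of_real (- (num_factor ?g n j * poly (lin_factor \<rho>1 j) y / den_factor r1 r2 \<rho>1 \<rho>2 j)))) (at 0)"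
      by (intro tendsto_sum tendsto_prod factor_lim den) auto
    moreover have "(\<Sum>k\<le>n. \<Prod>j<k. complex_of_real (- (num_factor ?g n j * poly (lin_factor \<rho>1 j) y / den_factor r1 r2 \<rho>1 \<rho>2 j)))
        = complex_of_real (poly (?R n) y)"
      unfolding poly_lim_poly[OF order_refl] coeff of_real_sum of_real_prod ..
    ultimately show ?thesis
      by (simp only: askey_wilson_sum[OF q_nz])
  qed

  show ?thesis
  proof (intro exI[of _ ?R] conjI allI impI)
    fix n y
    assume defd: "\<forall>\<^sub>F \<epsilon> in at 0. askey_wilson_defined n (a \<epsilon>) (b \<epsilon>) (c \<epsilon>) (d \<epsilon>) (q \<epsilon>)"
    note den = den_nz[OF defd]
    show deg: "degree (?R n) = n"
      by (rule lim_poly_top(1)[OF g den])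
    show "((\<lambda>\<epsilon>. askey_wilson n (a \<epsilon>) (b \<epsilon>) (c \<epsilon>) (d \<epsilon>) (q \<epsilon>) (z y \<epsilon>)) \<longlongrightarrow>
      complex_of_real (poly (?R n) y)) (at 0)"
      by (rule aw_lim[OF den])
    have "lead_coeff (?R n) \<noteq> 0"
      using lim_poly_top(2)[OF g den] deg by simp
    then show "poly (monic_version (?R n)) y = poly (bannai_ito r1 r2 \<rho>1 \<rho>2 n) (y - 1/4)"
      by (simp add: monic_version_def lim_poly_bannai_ito[OF g den])
  next
    fix n y
    assume "\<forall>\<^sub>F \<epsilon> in at 0. askey_wilson_defined (n + 1) (a \<epsilon>) (b \<epsilon>) (c \<epsilon>) (d \<epsilon>) (q \<epsilon>)"
    note den = den_nz[OF this]
    show "BI_A r1 r2 \<rho>1 \<rho>2 n * poly (?R (n + 1)) y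
           + (1/4 + \<rho>1 - BI_A r1 r2 \<rho>1 \<rho>2 n - BI_C r1 r2 \<rho>1 \<rho>2 n) * poly (?R n) y
           + BI_C r1 r2 \<rho>1 \<rho>2 n * poly (?R (n - 1)) y
           = y * poly (?R n) y"
      using lim_poly_recurrence[where n = n, OF g den] by simp
  qed
qed

end
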